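(* Let $S$ be the set of all triples $(x,y,z)$ of positive integers satisfying $$x^{(y^z)} = x^{(z^y)}.$$ Then $S = S_1 \cup S_2 \cup S_3 \cup S_4 \cup S_5$, where $$S_1 = \{(1,b,c) : b,c \in \mathbb{Z}^+\},$$ $$S_2 = \{(a,1,1) : a \in \mathbb{Z}^+,\ a \geq 2\},$$ $$S_3 = \{(a,b,b) : a,b \in \mathbb{Z}^+,\ a \geq 2,\ b \geq 2\},$$ $$S_4 = \{(a,4,2) : a \in \mathbb{Z}^+,\ a \geq 2\},$$ $$S_5 = \{(a,2,4) : a \in \mathbb{Z}^+,\ a \geq 2\}.$$
   Context: $\mathbb{Z}^+$ denotes the set of positive integers. *)

theory Defs
  imports Main
begin

end

theory Submission
  imports Defs
begin

text \<open>
  If \<open>b < c\<close> and \<open>b ^ c = c ^ b\<close>, then \<open>b ^ b\<close> divides \<open>c ^ b\<close>, so \<open>c = k * b\<close>; taking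
  \<open>b\<close>-th roots and cancelling \<open>b\<close> leaves \<open>b ^ (k - 1) = k\<close>, and exponential growth
  forces \<open>b = k = 2\<close>.
\<close>

text \<open>Equality holds at \<open>m = 0\<close> and \<open>m = 1\<close>, so the induction must
  start at 2.\<close>

lemma Suc_less_two_power:
  fixes m :: nat
  assumes "m \<ge> 2"
  shows "Suc m < 2 ^ m"
  using assms by (induction m rule: dec_induct) auto

lemma power_swap_eq_less:
  fixes b c :: nat
  assumes "0 < b" "b < c" and eq: "b ^ c = c ^ b"
  shows "b = 2 \<and> c = 4"
proof -
  have "b \<noteq> 1"
    using assms by auto
  with \<open>0 < b\<close> have "b \<ge> 2"
    by simp
  have "b ^ b dvd c ^ b"
    using \<open>b < c\<close> by (simp add: le_imp_power_dvd flip: eq)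
  with \<open>0 < b\<close> have "b dvd c"
    by simp
  then obtain k where k: "c = b * k" ..
  \<comment> \<open>\<open>k = 0\<close> would give \<open>c = 0\<close> and \<open>k = 1\<close>
    would give \<open>c = b\<close>, both against \<open>b < c\<close>.\<close>
  with \<open>b < c\<close> obtain m where m: "k = Suc m" "m \<noteq> 0"
    by (cases k) (auto intro: Nat.gr0I)
  have "(b ^ k) ^ b = c ^ b"
    using eq by (simp add: k mult.commute flip: power_mult)
  then have "b ^ k = c"
    using \<open>0 < b\<close> by (simp add: power_eq_iff_eq_base)
  then have "b * b ^ m = b * Suc m"
    by (simp add: k m)
  with \<open>0 < b\<close> have bm: "b ^ m = Suc m"
    by (simp only: mult_cancel1) simp
  moreover have "2 ^ m \<le> b ^ m"
    using \<open>b \<ge> 2\<close> by (simp add: power_mono)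
  \<comment> \<open>For \<open>m \<ge> 2\<close> the chain
    \<open>Suc m < 2 ^ m \<le> b ^ m = Suc m\<close> is absurd.\<close>
  ultimately have "m = 1"
    using Suc_less_two_power[of m] \<open>m \<noteq> 0\<close> by linarith
  with bm show ?thesis
    by (simp add: k m)
qed

text \<open>The equation is symmetric in \<open>b\<close> and \<open>c\<close>, so trichotomy
  reduces it to the strict case in either order; conversely, both powers of 2 and 4 are 16.\<close>

lemma power_swap_eq_iff:
  fixes b c :: nat
  assumes "0 < b" "0 < c"
  shows "b ^ c = c ^ b \<longleftrightarrow> b = c \<or> b = 2 \<and> c = 4 \<or> b = 4 \<and> c = 2"
proof
  assume "b ^ c = c ^ b"
  then show "b = c \<or> b = 2 \<and> c = 4 \<or> b = 4 \<and> c = 2"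
    using assms power_swap_eq_less[of b c] power_swap_eq_less[of c b]
    by (cases b c rule: linorder_cases) auto
qed auto

theorem theorem2:
  fixes S S1 S2 S3 S4 S5 :: "(nat \<times> nat \<times> nat) set"
  defines "S \<equiv> {(x, y, z). x > 0 \<and> y > 0 \<and> z > 0 \<and> x ^ (y ^ z) = x ^ (z ^ y)}"
    and "S1 \<equiv> {(1, b, c) | b c. b > 0 \<and> c > 0}"
    and "S2 \<equiv> {(a, 1, 1) | a. a > 0 \<and> a \<ge> 2}"
    and "S3 \<equiv> {(a, b, b) | a b. a > 0 \<and> b > 0 \<and> a \<ge> 2 \<and> b \<ge> 2}"
    and "S4 \<equiv> {(a, 4, 2) | a. a > 0 \<and> a \<ge> 2}"
    and "S5 \<equiv> {(a, 2, 4) | a. a > 0 \<and> a \<ge> 2}"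
  shows "S = S1 \<union> S2 \<union> S3 \<union> S4 \<union> S5"
proof -
  have mem: "(x, y, z) \<in> S \<longleftrightarrow> 0 < x \<and> 0 < y \<and> 0 < z \<and>
      (x = 1 \<or> y = z \<or> y = 2 \<and> z = 4 \<or> y = 4 \<and> z = 2)" for x y z
  proof (cases "x \<ge> 2 \<and> 0 < y \<and> 0 < z")
    case True
    \<comment> \<open>Powers of a base \<open>x \<ge> 2\<close> are injective in the
      exponent.\<close>
    then have "x ^ (y ^ z) = x ^ (z ^ y) \<longleftrightarrow> y ^ z = z ^ y"
      by simp
    with True show ?thesis
      by (simp add: S_def power_swap_eq_iff)
  next
    case False
    then have "x = 0 \<or> x = 1 \<or> y = 0 \<or> z = 0"
      by auto
    then show ?thesis
      by (auto simp: S_def)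
  qed
  \<comment> \<open>\<open>x = 1\<close> is \<open>S1\<close>; for \<open>x \<ge> 2\<close>, the
    diagonal \<open>y = z\<close> splits into \<open>S2\<close> (value 1) and \<open>S3\<close>
    (values from 2 on).\<close>
  have "(x, y, z) \<in> S \<longleftrightarrow> (x, y, z) \<in> S1 \<union> S2 \<union> S3 \<union> S4 \<union> S5" for x y z
    unfolding mem S1_def S2_def S3_def S4_def S5_def by auto
  then show ?thesis
    by auto
qed

end
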